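(* For $p\in(0,1)$, $\lambda\in(0,\infty)$ and $\mu\in\mathbb{R}$, put $\alpha=\sqrt{\frac{p}{1-p}}$ and $\beta=\frac{\lambda\alpha}{\alpha^2+1}$, and define $$\psi(x;\mu,\lambda,p)=\begin{cases}\beta\exp(-\lambda\alpha(x-\mu)), & x\ge\mu,\\ \beta\exp(\lambda\alpha^{-1}(x-\mu)), & x<\mu.\end{cases}$$ Then $\psi$ is the density of a constrained mixture of the Laplace distribution split at its mode; that is, it satisfies all four constraints (Continuity, Mixture, Volume, Weighting): 1. (Continuity) $\lim_{x\to\mu^+}\psi(x;\mu,\lambda,p)=\lim_{x\to\mu^-}\psi(x;\mu,\lambda,p)$ for all $\mu,\lambda,p$. 2. (Mixture) There are functions $\Theta_\pm:\mathbb{R}\times(0,\infty)\times(0,1)\to\mathbb{R}\times(0,\infty)$ and a constant $Z\in(0,\infty)$ such that for all $x\in\mathbb{R}$ and all $\mu,\lambda,p$, $$\psi(x;\mu,\lambda,p)\,Z=p\,\phi(x;\Theta_-(\mu,\lambda,p))\,\mathbb{I}[x<\mu]+(1-p)\,\phi(x;\Theta_+(\mu,\lambda,p))\,\mathbb{I}[x\ge\mu].$$ 3. (Volume) $\int_{-\infty}^{\infty}\psi(x;\mu,\lambda,p)\,dx=1$ for all $\mu,\lambda,p$. 4. (Weighting) $\int_{-\infty}^{\mu}\psi(x;\mu,\lambda,p)\,dx=p$ for all $\mu,\lambda,p$.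
   Context: The Laplace density with parameters $(\mu,\lambda)\in\mathbb{R}\times(0,\infty)$ is $\phi(x;\mu,\lambda)=\frac{\lambda}{2}\exp(-\lambda|x-\mu|)$, and $\mathbb{I}[\cdot]$ is the indicator function. A constrained mixture built from a base density is a density that is continuous at a split point $\mu$, and on each side of $\mu$ is (up to one common normalizing constant $Z$) the base density with suitable parameters given by the functions $\Theta_\pm$, with weights $p$ on the left and $1-p$ on the right. The split point is taken to be the mode $\mu$ of the base distribution, so the same symbol $\mu$ is used for both. *)

theory Defs
  imports "HOL-Analysis.Analysis"
begin

definition laplace_density :: "real \<Rightarrow> real \<times> real \<Rightarrow> real" where
  "laplace_density x \<theta> = (case \<theta> of (\<mu>, l) \<Rightarrow> l / 2 * exp (- l * \<bar>x - \<mu>\<bar>))"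

text \<open>A parametrised density takes the point \<open>x\<close> followed by its parameters. The first
  parameter \<open>\<mu>\<close> of the base density is its mode, and it is also the split point of the mixture.\<close>

definition base_params :: "(real \<times> real) set" where
  "base_params = UNIV \<times> {0<..}"

definition mixture_params :: "(real \<times> real \<times> real) set" where
  "mixture_params = UNIV \<times> {0<..} \<times> {0<..<1}"

text \<open>Equality of the one-sided limits includes their existence.\<close>

definition continuity_constraint :: "(real \<Rightarrow> real \<times> real \<times> real \<Rightarrow> real) \<Rightarrow> bool" where
  "continuity_constraint \<psi> \<longleftrightarrow>
    (\<forall>(\<mu>, l, p) \<in> mixture_params. \<exists>L.
       ((\<lambda>x. \<psi> x (\<mu>, l, p)) \<longlongrightarrow> L) (at_right \<mu>) \<and>
       ((\<lambda>x. \<psi> x (\<mu>, l, p)) \<longlongrightarrow> L) (at_left \<mu>))"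

text \<open>The constant \<open>Z\<close> is chosen once, independently of \<open>\<mu>\<close>, \<open>l\<close> and \<open>p\<close>.\<close>

definition mixture_constraint ::
    "(real \<Rightarrow> real \<times> real \<Rightarrow> real) \<Rightarrow> (real \<Rightarrow> real \<times> real \<times> real \<Rightarrow> real) \<Rightarrow> bool" where
  "mixture_constraint \<phi> \<psi> \<longleftrightarrow>
    (\<exists>\<Theta>minus \<in> mixture_params \<rightarrow> base_params.
     \<exists>\<Theta>plus \<in> mixture_params \<rightarrow> base_params.
     \<exists>Z>0. \<forall>x. \<forall>(\<mu>, l, p) \<in> mixture_params.
       \<psi> x (\<mu>, l, p) * Z =
         p * \<phi> x (\<Theta>minus (\<mu>, l, p)) * of_bool (x < \<mu>) +
         (1 - p) * \<phi> x (\<Theta>plus (\<mu>, l, p)) * of_bool (x \<ge> \<mu>))"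

text \<open>The Lebesgue integral of a non-integrable function is \<open>0\<close>, so the nonzero values
  required below entail integrability.\<close>

definition volume_constraint :: "(real \<Rightarrow> real \<times> real \<times> real \<Rightarrow> real) \<Rightarrow> bool" where
  "volume_constraint \<psi> \<longleftrightarrow>
    (\<forall>(\<mu>, l, p) \<in> mixture_params. (LBINT x. \<psi> x (\<mu>, l, p)) = 1)"

definition weighting_constraint :: "(real \<Rightarrow> real \<times> real \<times> real \<Rightarrow> real) \<Rightarrow> bool" where
  "weighting_constraint \<psi> \<longleftrightarrow>
    (\<forall>(\<mu>, l, p) \<in> mixture_params. (LBINT x:{..\<mu>}. \<psi> x (\<mu>, l, p)) = p)"

definition constrained_mixture ::
    "(real \<Rightarrow> real \<times> real \<Rightarrow> real) \<Rightarrow> (real \<Rightarrow> real \<times> real \<times> real \<Rightarrow> real) \<Rightarrow> bool" where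
  "constrained_mixture \<phi> \<psi> \<longleftrightarrow>
    continuity_constraint \<psi> \<and> mixture_constraint \<phi> \<psi> \<and>
    volume_constraint \<psi> \<and> weighting_constraint \<psi>"

definition split_laplace_density :: "real \<Rightarrow> real \<times> real \<times> real \<Rightarrow> real" where
  "split_laplace_density x \<theta> =
    (case \<theta> of (\<mu>, l, p) \<Rightarrow>
      let \<alpha> = sqrt (p / (1 - p)); \<beta> = l * \<alpha> / (\<alpha>\<^sup>2 + 1)
      in if x \<ge> \<mu> then \<beta> * exp (- l * \<alpha> * (x - \<mu>))
         else \<beta> * exp (l * inverse \<alpha> * (x - \<mu>)))"

end

theory Submission
  imports Defs
begin

text \<open>With \<open>\<alpha>\<^sup>2 = p / (1 - p)\<close> the weights are \<open>p = \<alpha>\<^sup>2 / (\<alpha>\<^sup>2 + 1)\<close> and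
  \<open>1 - p = 1 / (\<alpha>\<^sup>2 + 1)\<close>. Hence the two exponential pieces, of rates \<open>\<lambda> / \<alpha>\<close> on the left and
  \<open>\<lambda> \<alpha>\<close> on the right, have masses \<open>\<beta> \<alpha> / \<lambda> = p\<close> and \<open>\<beta> / (\<lambda> \<alpha>) = 1 - p\<close>, and
  \<open>p (\<lambda> / \<alpha>) = (1 - p) \<lambda> \<alpha> = \<beta>\<close>, so that the mixture constraint holds with \<open>Z = 1 / 2\<close>.\<close>

text \<open>The antiderivative \<open>- exp (- a * (x - c)) / a\<close> vanishes at infinity, so the
  fundamental theorem of calculus on a half-line applies. Because the integrand is nonnegative, its
  nonnegative integral yields integrability and the value at once.\<close>

lemma has_bochner_integral_exp_right:
  fixes a c :: real
  assumes "a > 0"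
  shows "has_bochner_integral lborel (\<lambda>x. exp (- a * (x - c)) * indicator {c..} x) (1 / a)"
proof (rule has_bochner_integral_nn_integral)
  have lim: "((\<lambda>x. - exp (- a * (x - c)) / a) \<longlongrightarrow> 0) at_top"
  proof -
    have "filterlim (\<lambda>x. - c + x) at_top at_top"
      by (intro filterlim_tendsto_add_at_top[OF tendsto_const] filterlim_ident)
    then have "filterlim (\<lambda>x. a * (- c + x)) at_top at_top"
      by (intro filterlim_tendsto_pos_mult_at_top[OF tendsto_const assms])
    then have "filterlim (\<lambda>x. - (a * (- c + x))) at_bot at_top"
      by (simp add: filterlim_uminus_at_top)
    then have "((\<lambda>x. exp (- (a * (- c + x)))) \<longlongrightarrow> 0) at_top"
      by (rule filterlim_compose[OF exp_at_bot])
    then have "((\<lambda>x. - exp (- (a * (- c + x))) / a) \<longlongrightarrow> - 0 / a) at_top"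
      by (intro tendsto_intros) (use assms in auto)
    then show ?thesis
      by (simp add: algebra_simps)
  qed
  \<comment> \<open>The value is the limit of the antiderivative at infinity minus its value at
    \<open>c\<close>.\<close>
  have "(\<integral>\<^sup>+x. ennreal (exp (- a * (x - c))) * indicator {c..} x \<partial>lborel) =
      ennreal (0 - (- exp (- a * (c - c)) / a))"
    by (rule nn_integral_FTC_atLeast[OF _ _ _ lim])
      (use assms in \<open>auto intro!: derivative_eq_intros\<close>)
  then show "(\<integral>\<^sup>+x. ennreal (exp (- a * (x - c)) * indicator {c..} x) \<partial>lborel) = ennreal (1 / a)"
    by (simp add: ennreal_mult' ennreal_indicator)
qed (use assms in \<open>auto simp: indicator_def\<close>)

text \<open>The reflection x -> -x carries this integral to the right-hand one with endpoint
  \<open>- c\<close>.\<close>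

lemma has_bochner_integral_exp_left:
  fixes a c :: real
  assumes "a > 0"
  shows "has_bochner_integral lborel (\<lambda>x. exp (a * (x - c)) * indicator {..c} x) (1 / a)"
proof -
  \<comment> \<open>The shape \<open>0 + - 1 * x\<close> is the affine substitution with offset 0
    and slope -1, whose Jacobian factor is 1.\<close>
  have "has_bochner_integral lborel
      (\<lambda>x. exp (- a * ((0 + - 1 * x) - (- c))) * indicator {- c..} (0 + - 1 * x)) ((1 / a) /\<^sub>R \<bar>- 1\<bar>)"
    using lborel_has_bochner_integral_real_affine_iff[of "- 1",
        THEN iffD1, OF _ has_bochner_integral_exp_right[OF assms, of "- c"], of 0] by simp
  moreover have "(\<lambda>x. exp (- a * ((0 + - 1 * x) - (- c))) * indicator {- c..} (0 + - 1 * x)) =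
      (\<lambda>x. exp (a * (x - c)) * indicator {..c} x :: real)"
    by (auto simp: fun_eq_iff indicator_def algebra_simps)
  ultimately show ?thesis
    by simp
qed

text \<open>Only \<open>l\<close> and \<open>p\<close> are constrained, so the exported predicate
  takes these two arguments and its facts hold for every split point. Likewise
  \<open>split_laplace.\<alpha>\<close> becomes a function of \<open>p\<close> alone.\<close>

locale split_laplace =
  fixes \<mu> l p :: real
  assumes l_pos: "l > 0" and p_pos: "p > 0" and p_less_1: "p < 1"
begin

definition \<alpha> :: real where "\<alpha> = sqrt (p / (1 - p))"

definition \<beta> :: real where "\<beta> = l * \<alpha> / (\<alpha>\<^sup>2 + 1)"

lemma \<alpha>_pos: "\<alpha> > 0"
  using p_pos p_less_1 by (simp add: \<alpha>_def)

lemma \<alpha>_squared: "\<alpha>\<^sup>2 = p / (1 - p)"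
  using p_pos p_less_1 by (simp add: \<alpha>_def)

lemma \<beta>_eq_right: "\<beta> = (1 - p) * (l * \<alpha>)"
proof -
  have "\<alpha>\<^sup>2 + 1 = 1 / (1 - p)"
    using p_less_1 by (simp add: \<alpha>_squared field_simps)
  then show ?thesis
    by (simp add: \<beta>_def)
qed

text \<open>Together with \<open>\<beta>_eq_right\<close> this says that the two weighted
  exponential densities have the same height at the split point, which is what continuity
  demands.\<close>

lemma \<beta>_eq_left: "\<beta> = p * (l / \<alpha>)"
proof -
  have "p * (l / \<alpha>) = (1 - p) * \<alpha>\<^sup>2 * (l / \<alpha>)"
    using p_less_1 by (simp add: \<alpha>_squared)
  also have "\<dots> = (1 - p) * (l * \<alpha>)"
    using \<alpha>_pos by (simp add: power2_eq_square)
  finally show ?thesis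
    by (simp add: \<beta>_eq_right)
qed

lemma density_right: "x \<ge> \<mu> \<Longrightarrow> split_laplace_density x (\<mu>, l, p) = \<beta> * exp (- (l * \<alpha>) * (x - \<mu>))"
  by (simp add: split_laplace_density_def \<alpha>_def \<beta>_def Let_def)

text \<open>The left formula extends to the split point itself, since both exponentials equal 1
  there. This permits the closed half-line \<open>{..\<mu>}\<close> below.\<close>

lemma density_left: "x \<le> \<mu> \<Longrightarrow> split_laplace_density x (\<mu>, l, p) = \<beta> * exp (l / \<alpha> * (x - \<mu>))"
  by (auto simp: split_laplace_density_def \<alpha>_def \<beta>_def Let_def field_simps)

lemma params_left: "(\<mu>, l / \<alpha>) \<in> base_params"
  and params_right: "(\<mu>, l * \<alpha>) \<in> base_params"
  using l_pos \<alpha>_pos by (simp_all add: base_params_def)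

text \<open>Each component keeps its mode at the split point, so the absolute value has constant
  sign on its side and the component is half of an exponential density. That half is the source of
  the factor \<open>1 / 2\<close>.\<close>

lemma density_mixture:
  "split_laplace_density x (\<mu>, l, p) * (1 / 2) =
    p * laplace_density x (\<mu>, l / \<alpha>) * of_bool (x < \<mu>) +
    (1 - p) * laplace_density x (\<mu>, l * \<alpha>) * of_bool (x \<ge> \<mu>)"
proof (cases "x < \<mu>")
  case True
  then have "\<bar>x - \<mu>\<bar> = - (x - \<mu>)"
    by simp
  then have "laplace_density x (\<mu>, l / \<alpha>) = l / \<alpha> / 2 * exp (l / \<alpha> * (x - \<mu>))"
    by (simp only: laplace_density_def prod.case minus_mult_minus)
  then show ?thesis
    using True by (simp add: density_left \<beta>_eq_left)
next
  case False
  then show ?thesis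
    by (simp add: density_right laplace_density_def \<beta>_eq_right algebra_simps)
qed

lemma tendsto_at_right:
  "((\<lambda>x. split_laplace_density x (\<mu>, l, p)) \<longlongrightarrow> \<beta>) (at_right \<mu>)"
proof (rule Lim_transform_eventually)
  show "((\<lambda>x. \<beta> * exp (- (l * \<alpha>) * (x - \<mu>))) \<longlongrightarrow> \<beta>) (at_right \<mu>)"
    by (auto intro!: tendsto_eq_intros)
  show "\<forall>\<^sub>F x in at_right \<mu>. \<beta> * exp (- (l * \<alpha>) * (x - \<mu>)) = split_laplace_density x (\<mu>, l, p)"
    by (auto simp: eventually_at_filter density_right)
qed

lemma tendsto_at_left:
  "((\<lambda>x. split_laplace_density x (\<mu>, l, p)) \<longlongrightarrow> \<beta>) (at_left \<mu>)"
proof (rule Lim_transform_eventually)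
  show "((\<lambda>x. \<beta> * exp (l / \<alpha> * (x - \<mu>))) \<longlongrightarrow> \<beta>) (at_left \<mu>)"
    using \<alpha>_pos by (auto intro!: tendsto_eq_intros)
  show "\<forall>\<^sub>F x in at_left \<mu>. \<beta> * exp (l / \<alpha> * (x - \<mu>)) = split_laplace_density x (\<mu>, l, p)"
    by (auto simp: eventually_at_filter density_left)
qed

lemma has_bochner_integral_left:
  "has_bochner_integral lborel (\<lambda>x. indicator {..\<mu>} x * split_laplace_density x (\<mu>, l, p)) p"
proof -
  have "has_bochner_integral lborel
      (\<lambda>x. \<beta> * (exp (l / \<alpha> * (x - \<mu>)) * indicator {..\<mu>} x)) (\<beta> * (1 / (l / \<alpha>)))"
    using l_pos \<alpha>_pos
    by (intro has_bochner_integral_mult_right has_bochner_integral_exp_left) auto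
  moreover have "(\<lambda>x. \<beta> * (exp (l / \<alpha> * (x - \<mu>)) * indicator {..\<mu>} x)) =
      (\<lambda>x. indicator {..\<mu>} x * split_laplace_density x (\<mu>, l, p))"
    by (auto simp: fun_eq_iff indicator_def density_left)
  moreover have "\<beta> * (1 / (l / \<alpha>)) = p"
    using l_pos \<alpha>_pos by (simp add: \<beta>_eq_left)
  ultimately show ?thesis
    by simp
qed

lemma has_bochner_integral_right:
  "has_bochner_integral lborel (\<lambda>x. indicator {\<mu>..} x * split_laplace_density x (\<mu>, l, p)) (1 - p)"
proof -
  have "has_bochner_integral lborel
      (\<lambda>x. \<beta> * (exp (- (l * \<alpha>) * (x - \<mu>)) * indicator {\<mu>..} x)) (\<beta> * (1 / (l * \<alpha>)))"
    using l_pos \<alpha>_pos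
    by (intro has_bochner_integral_mult_right has_bochner_integral_exp_right) auto
  moreover have "(\<lambda>x. \<beta> * (exp (- (l * \<alpha>) * (x - \<mu>)) * indicator {\<mu>..} x)) =
      (\<lambda>x. indicator {\<mu>..} x * split_laplace_density x (\<mu>, l, p))"
    by (auto simp: fun_eq_iff indicator_def density_right)
  moreover have "\<beta> * (1 / (l * \<alpha>)) = 1 - p"
    using l_pos \<alpha>_pos by (simp add: \<beta>_eq_right)
  ultimately show ?thesis
    by simp
qed

lemma set_integral_left: "(LBINT x:{..\<mu>}. split_laplace_density x (\<mu>, l, p)) = p"
  using has_bochner_integral_left
  by (simp add: set_lebesgue_integral_def has_bochner_integral_integral_eq)

text \<open>The masses \<open>p\<close> and \<open>1 - p\<close> of the two closed half-lines add
  up. Both contain \<mu>, where \<open>?g\<close> counts the density twice, but a single point is a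
  null set.\<close>

lemma integral_eq_1: "(LBINT x. split_laplace_density x (\<mu>, l, p)) = 1"
proof -
  let ?f = "\<lambda>x. split_laplace_density x (\<mu>, l, p)"
  let ?g = "\<lambda>x. indicator {..\<mu>} x * ?f x + indicator {\<mu>..} x * ?f x"
  have "has_bochner_integral lborel ?g (p + (1 - p))"
    by (intro has_bochner_integral_add has_bochner_integral_left has_bochner_integral_right)
  then have g: "?g \<in> borel_measurable lborel" "integral\<^sup>L lborel ?g = 1"
    by (auto dest: borel_measurable_has_bochner_integral has_bochner_integral_integral_eq)
  \<comment> \<open>Changing the measurable \<open>?g\<close> at one point gives \<open>?f\<close>;
    this supplies the measurability that \<open>integral_cong_AE\<close> requires.\<close>
  have f: "?f = (\<lambda>x. if x = \<mu> then \<beta> else ?g x)"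
    by (auto simp: fun_eq_iff density_right indicator_def)
  have "?f \<in> borel_measurable lborel"
    by (subst f) (use g(1) in measurable)
  moreover have "AE x in lborel. ?f x = ?g x"
    using AE_lborel_singleton[of \<mu>] by eventually_elim (auto simp: indicator_def)
  ultimately have "integral\<^sup>L lborel ?f = integral\<^sup>L lborel ?g"
    by (intro integral_cong_AE g(1))
  then show ?thesis
    using g(2) by simp
qed

end

lemma mixture_paramsD:
  assumes "(\<mu>, l, p) \<in> mixture_params"
  shows "split_laplace l p"
  using assms by (simp add: mixture_params_def split_laplace_def)

theorem theorem2: "constrained_mixture laplace_density split_laplace_density"
  unfolding constrained_mixture_def
proof (intro conjI)
  show "continuity_constraint split_laplace_density"
    unfolding continuity_constraint_def
    by (blast dest: mixture_paramsD
        intro: split_laplace.tendsto_at_left split_laplace.tendsto_at_right)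
  show "mixture_constraint laplace_density split_laplace_density"
  proof -
    let ?\<Theta>minus = "\<lambda>(\<mu> :: real, l, p). (\<mu>, l / split_laplace.\<alpha> p)"
    let ?\<Theta>plus = "\<lambda>(\<mu> :: real, l, p). (\<mu>, l * split_laplace.\<alpha> p)"
    have minus: "?\<Theta>minus \<in> mixture_params \<rightarrow> base_params"
      by (auto intro: split_laplace.params_left mixture_paramsD)
    have plus: "?\<Theta>plus \<in> mixture_params \<rightarrow> base_params"
      by (auto intro: split_laplace.params_right mixture_paramsD)
    show ?thesis
      unfolding mixture_constraint_def
    \<comment> \<open>The normalizing constant is fixed before the parameters, which is possible
      because \<open>1 / 2\<close> works for all of them.\<close>
    proof (rule bexI[OF _ minus], rule bexI[OF _ plus], intro exI[of _ "1 / 2"] conjI allI ballI)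
      fix x :: real and \<theta> :: "real \<times> real \<times> real"
      assume "\<theta> \<in> mixture_params"
      moreover obtain \<mu> l p where \<theta>: "\<theta> = (\<mu>, l, p)"
        by (cases \<theta>)
      ultimately have "split_laplace l p"
        by (auto intro: mixture_paramsD)
      then show "case \<theta> of (\<mu>, l, p) \<Rightarrow> split_laplace_density x (\<mu>, l, p) * (1 / 2) =
          p * laplace_density x (?\<Theta>minus (\<mu>, l, p)) * of_bool (x < \<mu>) +
          (1 - p) * laplace_density x (?\<Theta>plus (\<mu>, l, p)) * of_bool (x \<ge> \<mu>)"
        unfolding \<theta> prod.case by (rule split_laplace.density_mixture)
    qed simp
  qed
  show "volume_constraint split_laplace_density"
    unfolding volume_constraint_def
    by clarify (rule split_laplace.integral_eq_1[OF mixture_paramsD])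
  show "weighting_constraint split_laplace_density"
    unfolding weighting_constraint_def
    by clarify (rule split_laplace.set_integral_left[OF mixture_paramsD])
qed

end
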